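(* Let $Q$ be a finite abelian group of order $q$ which is also a commutative ring with unity and has a generating character $\chi$. Let $G=(V,E)$ be a finite graph with a fixed orientation, $\partial:Q^E\to Q^V$ its boundary map and $\delta:Q^V\to Q^E$ its coboundary map. For $g\in\mathbb{C}^Q$, $$\mathrm{cwe}(\ker(\partial);g\cdot g^N)=q^{-|V|}\sum_{x\in Q^V}\prod_{e\in E}\sum_{b\in Q}\prod_{v\in e}g^F(x_v-b)=q^{-|V|}\sum_{y\in Q^E}\prod_{v\in V}\sum_{a\in Q}\prod_{e\ni v}g^F(a-y_e).$$ Equivalently, if $X$ is uniformly distributed on $Q^V$ and $Y$ uniformly distributed on $Q^E$ (independently), then $\mathrm{cwe}(\ker(\partial);g\cdot g^N)=q^{|E|}\,\mathbb{E}\big[\prod_{(v,e)\in H}g^F(X_v-Y_e)\big].$ Similarly, for $f\in\mathbb{C}^Q$, $$\mathrm{cwe}(\mathrm{im}(\delta);f\ast f^N)=q^{|E|+r(E)}\,\mathbb{E}\Big[\prod_{(v,e)\in H}f(X_v-Y_e)\Big].$$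
   Context: A character of $Q$ is a homomorphism $\chi:(Q,+)\to\mathbb{C}^\times$; it is generating if $a\mapsto(b\mapsto\chi(ab))$ is an isomorphism from $Q$ onto its character group. The (unitary) Fourier transform of $g\in\mathbb{C}^Q$ is $g^F(a)=q^{-1/2}\sum_{b\in Q}\chi(ab)g(b)$. Define $g^N(a)=g(-a)$, $(g\cdot h)(a)=g(a)h(a)$ and $(f\ast h)(a)=\sum_{b\in Q}f(a-b)h(b)$. Graphs may have loops and multiple edges. The set of half-edges is $H=\{(v,e):v\text{ an endpoint of }e\}$ (a loop contributes two half-edges); $\prod_{v\in e}$ is over the two half-edges of $e$ and $\prod_{e\ni v}$ over the half-edges at $v$. With the orientation encoded by $\sigma_{v,e}=+1$ if $e$ is directed into $v$, $-1$ if directed out of $v$, $0$ if $v\notin e$: $(\partial y)_v=\sum_e\sigma_{v,e}y_e$ and $(\delta x)_e=\sum_v\sigma_{v,e}x_v$. Elements of $\ker(\partial)$ are $Q$-flows and of $\mathrm{im}(\delta)$ are $Q$-tensions. For $S\subseteq Q^E$ and $h\in\mathbb{C}^Q$, the complete weight enumerator is $\mathrm{cwe}(S;h)=\sum_{y\in S}\prod_{e\in E}h(y_e)$. $r(E)=|V|-k(G)$ where $k(G)$ is the number of connected components. *)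

theory Defs
  imports
    "HOL-Probability.Probability"
    "HOL-Algebra.Group"
    "Graph_Theory.Digraph_Component"
begin

section \<open>Characters and the Fourier transform\<close>

text \<open>
  The ring \<open>Q\<close> is a type of class \<open>comm_ring\<close> and \<open>finite\<close>; its unity is a hypothesis of the theorem
  rather than part of the class, because \<open>comm_ring_1\<close> would exclude the zero ring (\<open>q = 1\<close>).
\<close>

definition add_grp :: "'q::comm_ring monoid" where
  "add_grp = \<lparr>carrier = UNIV, mult = (+), one = 0\<rparr>"

definition complex_units :: "complex monoid" where
  "complex_units = \<lparr>carrier = UNIV - {0}, mult = (*), one = 1\<rparr>"

definition characters :: "('q::comm_ring \<Rightarrow> complex) set" where
  "characters = hom add_grp complex_units"

definition character_group :: "('q::comm_ring \<Rightarrow> complex) monoid" where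
  "character_group =
     \<lparr>carrier = characters, mult = (\<lambda>\<phi> \<psi> a. \<phi> a * \<psi> a), one = (\<lambda>_. 1)\<rparr>"

definition generating_character :: "('q::comm_ring \<Rightarrow> complex) \<Rightarrow> bool" where
  "generating_character chi \<longleftrightarrow>
     chi \<in> characters \<and> (\<lambda>a b. chi (a * b)) \<in> iso add_grp character_group"

definition fourier ::
  "('q::{comm_ring,finite} \<Rightarrow> complex) \<Rightarrow> ('q \<Rightarrow> complex) \<Rightarrow> 'q \<Rightarrow> complex" where
  "fourier chi g a =
     complex_of_real (real CARD('q) powr (- 1 / 2)) * (\<Sum>b\<in>UNIV. chi (a * b) * g b)"

definition reflect :: "('q::comm_ring \<Rightarrow> complex) \<Rightarrow> 'q \<Rightarrow> complex" where
  "reflect g a = g (- a)"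

definition ptmult :: "('q \<Rightarrow> complex) \<Rightarrow> ('q \<Rightarrow> complex) \<Rightarrow> 'q \<Rightarrow> complex" where
  "ptmult g h a = g a * h a"

definition convol ::
  "('q::{comm_ring,finite} \<Rightarrow> complex) \<Rightarrow> ('q \<Rightarrow> complex) \<Rightarrow> 'q \<Rightarrow> complex" where
  "convol f h a = (\<Sum>b\<in>UNIV. f (a - b) * h b)"

section \<open>Oriented multigraphs\<close>

text \<open>
  A finite graph (loops and multiple edges allowed) with a fixed orientation is a
  \<open>fin_digraph\<close>: its arcs are the edges, each directed from \<open>tail\<close> to \<open>head\<close>.
  \<open>Q\<^sup>V\<close> and \<open>Q\<^sup>E\<close> are rendered by extensional functions.
\<close>

abbreviation vertex_funs :: "('v, 'e) pre_digraph \<Rightarrow> ('v \<Rightarrow> 'q) set" where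
  "vertex_funs G \<equiv> verts G \<rightarrow>\<^sub>E UNIV"

abbreviation edge_funs :: "('v, 'e) pre_digraph \<Rightarrow> ('e \<Rightarrow> 'q) set" where
  "edge_funs G \<equiv> arcs G \<rightarrow>\<^sub>E UNIV"

text \<open>
  A half-edge is an edge tagged with one of its two ends (\<open>True\<close>: head end, \<open>False\<close>: tail end).
  The pair (vertex, edge) alone would identify the two half-edges of a loop.
\<close>

definition half_edges :: "('v, 'e) pre_digraph \<Rightarrow> ('e \<times> bool) set" where
  "half_edges G = arcs G \<times> UNIV"

definition hvert :: "('v, 'e) pre_digraph \<Rightarrow> 'e \<times> bool \<Rightarrow> 'v" where
  "hvert G h = (if snd h then head G (fst h) else tail G (fst h))"

abbreviation hedge :: "'e \<times> bool \<Rightarrow> 'e" where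
  "hedge \<equiv> fst"

text \<open>
  A loop is directed both into and out of its vertex, so its two contributions cancel.
\<close>

definition sigma :: "('v, 'e) pre_digraph \<Rightarrow> 'v \<Rightarrow> 'e \<Rightarrow> int" where
  "sigma G v e = (if head G e = v then 1 else 0) - (if tail G e = v then 1 else 0)"

text \<open>Integer multiple \<open>n\<cdot>a\<close> in the abelian group \<open>(Q,+)\<close>.\<close>

definition int_multiple :: "int \<Rightarrow> 'q::comm_ring \<Rightarrow> 'q" where
  "int_multiple n a = a [^]\<^bsub>add_grp\<^esub> n"

definition boundary :: "('v, 'e) pre_digraph \<Rightarrow> ('e \<Rightarrow> 'q::comm_ring) \<Rightarrow> 'v \<Rightarrow> 'q" where
  "boundary G y = (\<lambda>v\<in>verts G. \<Sum>e\<in>arcs G. int_multiple (sigma G v e) (y e))"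

definition coboundary :: "('v, 'e) pre_digraph \<Rightarrow> ('v \<Rightarrow> 'q::comm_ring) \<Rightarrow> 'e \<Rightarrow> 'q" where
  "coboundary G x = (\<lambda>e\<in>arcs G. \<Sum>v\<in>verts G. int_multiple (sigma G v e) (x v))"

definition flows :: "('v, 'e) pre_digraph \<Rightarrow> ('e \<Rightarrow> 'q::comm_ring) set" where
  "flows G = {y \<in> edge_funs G. boundary G y = (\<lambda>v\<in>verts G. 0)}"

definition tensions :: "('v, 'e) pre_digraph \<Rightarrow> ('e \<Rightarrow> 'q::comm_ring) set" where
  "tensions G = coboundary G ` vertex_funs G"

definition cwe ::
  "('v, 'e) pre_digraph \<Rightarrow> ('e \<Rightarrow> 'q) set \<Rightarrow> ('q \<Rightarrow> complex) \<Rightarrow> complex" where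
  "cwe G S h = (\<Sum>y\<in>S. \<Prod>e\<in>arcs G. h (y e))"

text \<open>
  Connected components of the underlying undirected graph are the strong components of the
  symmetric closure.
\<close>

definition num_components :: "('v, 'e) pre_digraph \<Rightarrow> nat" where
  "num_components G = card (pre_digraph.sccs_verts (with_proj (mk_symmetric G)))"

text \<open>The subtraction does not truncate, as every component contains a vertex.\<close>

definition graph_rank :: "('v, 'e) pre_digraph \<Rightarrow> nat" where
  "graph_rank G = card (verts G) - num_components G"

section \<open>Uniformly distributed random variables\<close>

definition uniformly_distributed :: "'w measure \<Rightarrow> 'a set \<Rightarrow> ('w \<Rightarrow> 'a) \<Rightarrow> bool" where
  "uniformly_distributed M A X \<longleftrightarrow>
     X \<in> measurable M (count_space A) \<and> distr M (count_space A) X = uniform_count_measure A"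

text \<open>
  Independence of \<open>X\<close> and \<open>Y\<close> is independence of the \<open>\<sigma>\<close>-algebras they generate; \<open>indep_var\<close> cannot be
  used because it needs both variables to take values in the same type.
\<close>

definition independent_uniform ::
  "'w measure \<Rightarrow> 'a set \<Rightarrow> ('w \<Rightarrow> 'a) \<Rightarrow> 'b set \<Rightarrow> ('w \<Rightarrow> 'b) \<Rightarrow> bool" where
  "independent_uniform M A X B Y \<longleftrightarrow>
     prob_space M \<and> uniformly_distributed M A X \<and> uniformly_distributed M B Y \<and>
     prob_space.indep_set M {X -` S \<inter> space M |S. S \<subseteq> A} {Y -` T \<inter> space M |T. T \<subseteq> B}"

end

theory Submission
  imports Defs
begin

text \<open>
  Summing the product over half-edges first over \<open>y\<close> leaves, for each edge, a correlation
  \<open>\<Sum>b. \<phi> (u - b) * \<phi> (w - b)\<close> of the values at its two ends. For \<open>\<phi> = f\<close> it is the convolution at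
  \<open>u - w\<close>, and the tension formula follows because every fibre of \<open>\<delta>\<close> is a coset of the functions
  that are constant on components. For \<open>\<phi> = g\<^sup>F\<close>, orthogonality of characters turns it into the
  Fourier transform of \<open>g \<cdot> g\<^sup>N\<close> at \<open>u - w\<close>; expanding the product over edges, \<open>\<partial>\<close> being the
  transpose of \<open>\<delta>\<close>, a second use of orthogonality in the sum over \<open>x\<close> selects the flows.
\<close>

section \<open>Expectations over independent uniform variables\<close>

lemma uniformly_distributed_prob:
  assumes "uniformly_distributed M A X" "finite A" "x \<in> A"
  shows "measure M (X -` {x} \<inter> space M) = 1 / card A"
proof -
  have "measure M (X -` {x} \<inter> space M) = measure (distr M (count_space A) X) {x}"
    using assms by (intro measure_distr [symmetric]) (auto simp: uniformly_distributed_def)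
  also have "\<dots> = 1 / card A"
    using assms by (simp add: uniformly_distributed_def measure_uniform_count_measure)
  finally show ?thesis .
qed

text \<open>The integrand takes finitely many values, so the integral is a finite sum over the pairs
  (x, y); independence makes all these pairs equally likely.\<close>

lemma integral_independent_uniform:
  fixes \<phi> :: "'a \<Rightarrow> 'b \<Rightarrow> complex"
  assumes indep: "independent_uniform M A X B Y" and fin: "finite A" "finite B"
  shows "(\<integral>\<omega>. \<phi> (X \<omega>) (Y \<omega>) \<partial>M) = (\<Sum>x\<in>A. \<Sum>y\<in>B. \<phi> x y) / (of_nat (card A) * of_nat (card B))"
proof -
  interpret prob_space M using indep by (simp add: independent_uniform_def)
  have uX: "uniformly_distributed M A X" and uY: "uniformly_distributed M B Y"
    and ind: "indep_set {X -` S \<inter> space M |S. S \<subseteq> A} {Y -` T \<inter> space M |T. T \<subseteq> B}"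
    using indep by (auto simp: independent_uniform_def)
  have mX: "X \<in> measurable M (count_space A)" and mY: "Y \<in> measurable M (count_space B)"
    using uX uY by (auto simp: uniformly_distributed_def)
  \<comment> \<open>For x in \<open>A\<close> and y in \<open>B\<close> these events partition the
    space, and the integrand is constant on each of them.\<close>
  define D where "D x y = (X -` {x} \<inter> space M) \<inter> (Y -` {y} \<inter> space M)" for x y
  have D: "D x y \<in> events" if "x \<in> A" "y \<in> B" for x y
    using that measurable_sets[OF mX, of "{x}"] measurable_sets[OF mY, of "{y}"]
    by (auto simp: D_def)
  have prob_D: "prob (D x y) = 1 / (card A * card B)" if "x \<in> A" "y \<in> B" for x y
  proof -
    have "prob (D x y) = prob (X -` {x} \<inter> space M) * prob (Y -` {y} \<inter> space M)"
      unfolding D_def using that by (intro indep_setD[OF ind]) auto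
    then show ?thesis
      using that by (simp add: uniformly_distributed_prob[OF uX fin(1)] uniformly_distributed_prob[OF uY fin(2)])
  qed
  have "(\<integral>\<omega>. \<phi> (X \<omega>) (Y \<omega>) \<partial>M) =
      (\<integral>\<omega>. (\<Sum>x\<in>A. \<Sum>y\<in>B. indicator (D x y) \<omega> *\<^sub>R \<phi> x y) \<partial>M)"
  proof (rule Bochner_Integration.integral_cong[OF refl])
    fix \<omega> assume \<omega>: "\<omega> \<in> space M"
    then have XY: "X \<omega> \<in> A" "Y \<omega> \<in> B"
      using measurable_space[OF mX] measurable_space[OF mY] by auto
    have "(\<Sum>x\<in>A. \<Sum>y\<in>B. indicator (D x y) \<omega> *\<^sub>R \<phi> x y) =
        (\<Sum>x\<in>A. \<Sum>y\<in>B. if X \<omega> = x then if Y \<omega> = y then \<phi> x y else 0 else 0)"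
      using \<omega> by (intro sum.cong refl) (auto simp: D_def)
    also have "\<dots> = (\<Sum>x\<in>A. if X \<omega> = x then \<phi> x (Y \<omega>) else 0)"
      using XY fin by (intro sum.cong refl) auto
    also have "\<dots> = \<phi> (X \<omega>) (Y \<omega>)"
      using XY fin by simp
    finally show "\<phi> (X \<omega>) (Y \<omega>) = (\<Sum>x\<in>A. \<Sum>y\<in>B. indicator (D x y) \<omega> *\<^sub>R \<phi> x y)" ..
  qed
  also have "\<dots> = (\<Sum>x\<in>A. \<Sum>y\<in>B. prob (D x y) *\<^sub>R \<phi> x y)"
    using D by (simp add: less_top[symmetric])
  also have "\<dots> = (\<Sum>x\<in>A. \<Sum>y\<in>B. \<phi> x y / (of_nat (card A) * of_nat (card B)))"
    by (intro sum.cong refl) (simp add: prob_D scaleR_conv_of_real)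
  finally show ?thesis
    by (simp add: sum_divide_distrib)
qed

section \<open>The boundary and coboundary maps\<close>

lemma group_add_grp: "group (add_grp :: 'q::comm_ring monoid)"
proof (rule groupI)
  fix a :: 'q
  have "- a \<otimes>\<^bsub>add_grp\<^esub> a = \<one>\<^bsub>add_grp\<^esub>"
    by (simp add: add_grp_def)
  then show "\<exists>b\<in>carrier add_grp. b \<otimes>\<^bsub>add_grp\<^esub> a = \<one>\<^bsub>add_grp\<^esub>"
    by (intro bexI[of _ "- a"]) (simp_all add: add_grp_def)
qed (simp_all add: add_grp_def add.assoc)

text \<open>The coefficient is 1, -1 or 0, so the group power is a, its inverse -a, or 0. At a loop
  both conditionals hold and cancel, which agrees with coefficient 0. From here on, only ring
  arithmetic is needed.\<close>

lemma int_multiple_sigma: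
  "int_multiple (sigma G v e) a = (if head G e = v then a else 0) - (if tail G e = v then a else 0)"
proof -
  interpret A: group "add_grp :: 'a monoid" by (rule group_add_grp)
  have inv: "inv\<^bsub>add_grp\<^esub> a = - a"
    by (rule A.inv_equality) (auto simp: add_grp_def)
  show ?thesis
    using A.int_pow_neg[of a 1] A.int_pow_1[of a] inv
    by (auto simp: int_multiple_def sigma_def add_grp_def)
qed

lemma coboundary_apply:
  assumes "fin_digraph G" "e \<in> arcs G"
  shows "coboundary G x e = x (head G e) - x (tail G e)"
proof -
  interpret fin_digraph G by fact
  show ?thesis
    using assms by (simp add: coboundary_def int_multiple_sigma sum_subtractf)
qed

text \<open>The integer coefficient \<open>sigma G v e\<close> can be moved from the factor x v to
  the factor y e; exchanging the two sums then collects the boundary at each vertex.\<close>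

lemma boundary_coboundary_adjoint:
  assumes "fin_digraph G"
  shows "(\<Sum>e\<in>arcs G. coboundary G x e * y e) = (\<Sum>v\<in>verts G. x v * boundary G y v)"
proof -
  have "(\<Sum>e\<in>arcs G. coboundary G x e * y e) =
      (\<Sum>e\<in>arcs G. \<Sum>v\<in>verts G. int_multiple (sigma G v e) (x v) * y e)"
    by (simp add: coboundary_def sum_distrib_right)
  also have "\<dots> = (\<Sum>e\<in>arcs G. \<Sum>v\<in>verts G. x v * int_multiple (sigma G v e) (y e))"
    by (intro sum.cong refl) (simp add: int_multiple_sigma algebra_simps)
  also have "\<dots> = (\<Sum>v\<in>verts G. x v * boundary G y v)"
    by (subst sum.swap) (simp add: boundary_def sum_distrib_left)
  finally show ?thesis .
qed

section \<open>Characters, orthogonality and correlations\<close>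

lemma character_add: "chi \<in> characters \<Longrightarrow> chi (a + b) = chi a * chi b"
  by (auto simp: characters_def hom_def add_grp_def complex_units_def)

lemma character_nonzero: "chi \<in> characters \<Longrightarrow> chi a \<noteq> 0"
  by (auto simp: characters_def hom_def add_grp_def complex_units_def)

lemma character_zero: "chi \<in> characters \<Longrightarrow> chi 0 = 1"
  using character_add[of chi 0 0] character_nonzero[of chi 0] by simp

lemma character_sum:
  assumes "chi \<in> characters"
  shows "chi (\<Sum>i\<in>I. a i) = (\<Prod>i\<in>I. chi (a i))"
  by (induction I rule: infinite_finite_induct)
    (simp_all add: assms character_add character_zero)

text \<open>If chi were 1 on all multiples of a nonzero c, then c and 0 would induce the same
  character, against injectivity. So some b has chi (b * c) different from 1; translating the
  summation variable by b multiplies the sum by this value, which forces the sum to vanish.\<close>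

lemma generating_character_orthogonality:
  fixes chi :: "'q::{comm_ring,finite} \<Rightarrow> complex"
  assumes gen: "generating_character chi"
  shows "(\<Sum>a\<in>UNIV. chi (a * c)) = (if c = 0 then of_nat CARD('q) else 0)"
proof -
  have chi: "chi \<in> characters" and inj: "inj (\<lambda>a b. chi (a * b))"
    using gen by (auto simp: generating_character_def iso_def bij_betw_def add_grp_def)
  show ?thesis
  proof (cases "c = 0")
    case True
    then show ?thesis by (simp add: character_zero[OF chi])
  next
    case False
    have "\<exists>b. chi (c * b) \<noteq> 1"
    proof (rule ccontr)
      assume "\<not> ?thesis"
      then have "(\<lambda>b. chi (c * b)) = (\<lambda>b. chi (0 * b))"
        by (simp add: character_zero[OF chi])
      then show False using injD[OF inj] False by blast
    qed
    then obtain b where b: "chi (b * c) \<noteq> 1" by (auto simp: mult.commute)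
    have "(\<Sum>a\<in>UNIV. chi (a * c)) = (\<Sum>a\<in>UNIV. chi ((b + a) * c))"
      by (rule sum.reindex_bij_witness[of _ "\<lambda>a. b + a" "\<lambda>a. a - b"]) auto
    also have "\<dots> = chi (b * c) * (\<Sum>a\<in>UNIV. chi (a * c))"
      by (simp add: distrib_right character_add[OF chi] sum_distrib_left)
    finally show ?thesis using b False by simp
  qed
qed

text \<open>Expanding both transforms gives a triple sum over b, c and d. Summing over b first
  leaves a single sum over c by orthogonality.\<close>

lemma sum_fourier_shift:
  fixes chi :: "'q::{comm_ring,finite} \<Rightarrow> complex"
  assumes gen: "generating_character chi"
  shows "(\<Sum>b\<in>UNIV. fourier chi g (u - b) * fourier chi g (w - b)) =
    (\<Sum>c\<in>UNIV. chi ((u - w) * c) * ptmult g (reflect g) c)"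
proof -
  have chi: "chi \<in> characters"
    using gen by (simp add: generating_character_def)
  define s where "s = complex_of_real (real CARD('q) powr (- 1 / 2))"
  \<comment> \<open>The two normalising factors cancel exactly the factor q that orthogonality
    produces.\<close>
  have s: "s * s * of_nat CARD('q) = 1"
  proof -
    have "s * s = complex_of_real (real CARD('q) powr (- 1))"
      by (simp add: s_def flip: of_real_mult powr_add)
    then show ?thesis by (simp add: powr_minus)
  qed
  \<comment> \<open>This isolates the dependence on b in a single character value.\<close>
  have chi_eq: "chi ((u - b) * c) * chi ((w - b) * d) =
      chi (u * c + w * d) * chi (b * (- (c + d)))" for b c d
    by (simp add: algebra_simps flip: character_add[OF chi])
  have fourier_eq: "fourier chi g a = (\<Sum>c\<in>UNIV. s * (chi (a * c) * g c))" for a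
    by (simp only: fourier_def s_def sum_distrib_left)
  have "(\<Sum>b\<in>UNIV. fourier chi g (u - b) * fourier chi g (w - b)) =
      (\<Sum>b\<in>UNIV. \<Sum>c\<in>UNIV. \<Sum>d\<in>UNIV. s * s * (chi ((u - b) * c) * chi ((w - b) * d)) * (g c * g d))"
    unfolding fourier_eq sum_product by (intro sum.cong refl) (simp only: mult_ac)
  also have "\<dots> = (\<Sum>c\<in>UNIV. \<Sum>b\<in>UNIV. \<Sum>d\<in>UNIV.
      s * s * (chi ((u - b) * c) * chi ((w - b) * d)) * (g c * g d))"
    by (rule sum.swap)
  also have "\<dots> = (\<Sum>c\<in>UNIV. \<Sum>d\<in>UNIV. \<Sum>b\<in>UNIV.
      s * s * (chi ((u - b) * c) * chi ((w - b) * d)) * (g c * g d))"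
    by (intro sum.cong refl sum.swap)
  also have "\<dots> = (\<Sum>c\<in>UNIV. \<Sum>d\<in>UNIV.
      s * s * chi (u * c + w * d) * (g c * g d) * (\<Sum>b\<in>UNIV. chi (b * (- (c + d)))))"
    unfolding chi_eq sum_distrib_left by (intro sum.cong refl) (simp only: mult_ac)
  \<comment> \<open>Only the terms with d = -c survive; they pair g c with g (-c), whence the
    reflection of g and the difference u - w.\<close>
  also have "\<dots> = (\<Sum>c\<in>UNIV. \<Sum>d\<in>UNIV.
      if d = - c then (s * s * of_nat CARD('q)) * chi (u * c + w * d) * (g c * g d) else 0)"
    unfolding generating_character_orthogonality[OF gen]
    by (intro sum.cong refl) (auto simp: add_eq_0_iff)
  also have "\<dots> = (\<Sum>c\<in>UNIV. chi ((u - w) * c) * ptmult g (reflect g) c)"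
    by (simp add: s ptmult_def reflect_def left_diff_distrib)
  finally show ?thesis .
qed

text \<open>Replacing b by b + w turns the two arguments into (u - w) - b and -b.\<close>

lemma sum_shift_eq_convol:
  fixes f :: "'q::{comm_ring,finite} \<Rightarrow> complex"
  shows "(\<Sum>b\<in>UNIV. f (u - b) * f (w - b)) = convol f (reflect f) (u - w)"
  unfolding convol_def reflect_def
  by (rule sum.reindex_bij_witness[of _ "\<lambda>b. b + w" "\<lambda>b. b - w"]) (auto simp: algebra_simps)

text \<open>Because of the Boolean tag, a loop also has two distinct half-edges, so the product over
  the ends of an edge always has two factors.\<close>

lemma half_edges_of_edge:
  "e \<in> arcs G \<Longrightarrow> {h. h \<in> half_edges G \<and> hedge h = e} = {(e, True), (e, False)}"
  by (auto simp: half_edges_def)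

section \<open>Half-edge sums, grouped by edge or by vertex\<close>

context fin_digraph
begin

lemma finite_half_edges: "finite (half_edges G)"
  by (simp add: half_edges_def)

lemma finite_vertex_funs: "finite (vertex_funs G :: ('a \<Rightarrow> 'q::finite) set)"
  by (intro finite_PiE) auto

lemma finite_edge_funs: "finite (edge_funs G :: ('b \<Rightarrow> 'q::finite) set)"
  by (intro finite_PiE) auto

lemma card_vertex_funs: "card (vertex_funs G :: ('a \<Rightarrow> 'q::finite) set) = CARD('q) ^ card (verts G)"
  by (simp add: card_PiE)

lemma card_edge_funs: "card (edge_funs G :: ('b \<Rightarrow> 'q::finite) set) = CARD('q) ^ card (arcs G)"
  by (simp add: card_PiE)

text \<open>For fixed x this is the distributive law: choosing a summand b independently for each
  edge amounts to choosing an edge function y.\<close>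

lemma sum_half_edges_by_edge:
  fixes \<phi> :: "'q::{comm_ring,finite} \<Rightarrow> complex"
  shows "(\<Sum>x\<in>vertex_funs G. \<Sum>y\<in>edge_funs G. \<Prod>h\<in>half_edges G. \<phi> (x (hvert G h) - y (hedge h))) =
    (\<Sum>x\<in>vertex_funs G. \<Prod>e\<in>arcs G. \<Sum>b\<in>UNIV.
      \<Prod>h | h \<in> half_edges G \<and> hedge h = e. \<phi> (x (hvert G h) - b))"
proof (rule sum.cong[OF refl])
  fix x :: "'a \<Rightarrow> 'q"
  have "(\<Prod>e\<in>arcs G. \<Sum>b\<in>UNIV. \<Prod>h | h \<in> half_edges G \<and> hedge h = e. \<phi> (x (hvert G h) - b)) =
      (\<Sum>y\<in>edge_funs G. \<Prod>e\<in>arcs G. \<Prod>h | h \<in> half_edges G \<and> hedge h = e. \<phi> (x (hvert G h) - y e))"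
    by (rule prod_sum_PiE) auto
  \<comment> \<open>Writing y (hedge h) for y e makes the factor depend on h alone, so that the
    products over the fibres of \<open>hedge\<close> merge into one over all half-edges.\<close>
  also have "\<dots> = (\<Sum>y\<in>edge_funs G. \<Prod>e\<in>arcs G. \<Prod>h | h \<in> half_edges G \<and> hedge h = e.
      \<phi> (x (hvert G h) - y (hedge h)))"
    by (intro sum.cong prod.cong) auto
  also have "\<dots> = (\<Sum>y\<in>edge_funs G. \<Prod>h\<in>half_edges G. \<phi> (x (hvert G h) - y (hedge h)))"
    by (intro sum.cong refl prod.group finite_half_edges finite_arcs) (auto simp: half_edges_def)
  finally show "(\<Sum>y\<in>edge_funs G. \<Prod>h\<in>half_edges G. \<phi> (x (hvert G h) - y (hedge h))) =
      (\<Prod>e\<in>arcs G. \<Sum>b\<in>UNIV. \<Prod>h | h \<in> half_edges G \<and> hedge h = e. \<phi> (x (hvert G h) - b))" ..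
qed

text \<open>The same distributive law for fixed y, with the values of x chosen vertex by vertex. An
  isolated vertex has an empty product and contributes the factor q on both sides.\<close>

lemma sum_half_edges_by_vertex:
  fixes \<phi> :: "'q::{comm_ring,finite} \<Rightarrow> complex"
  shows "(\<Sum>x\<in>vertex_funs G. \<Sum>y\<in>edge_funs G. \<Prod>h\<in>half_edges G. \<phi> (x (hvert G h) - y (hedge h))) =
    (\<Sum>y\<in>edge_funs G. \<Prod>v\<in>verts G. \<Sum>a\<in>UNIV.
      \<Prod>h | h \<in> half_edges G \<and> hvert G h = v. \<phi> (a - y (hedge h)))"
proof (subst sum.swap, rule sum.cong[OF refl])
  fix y :: "'b \<Rightarrow> 'q"
  have "(\<Prod>v\<in>verts G. \<Sum>a\<in>UNIV. \<Prod>h | h \<in> half_edges G \<and> hvert G h = v. \<phi> (a - y (hedge h))) =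
      (\<Sum>x\<in>vertex_funs G. \<Prod>v\<in>verts G. \<Prod>h | h \<in> half_edges G \<and> hvert G h = v. \<phi> (x v - y (hedge h)))"
    by (rule prod_sum_PiE) auto
  also have "\<dots> = (\<Sum>x\<in>vertex_funs G. \<Prod>v\<in>verts G. \<Prod>h | h \<in> half_edges G \<and> hvert G h = v.
      \<phi> (x (hvert G h) - y (hedge h)))"
    by (intro sum.cong prod.cong) auto
  also have "\<dots> = (\<Sum>x\<in>vertex_funs G. \<Prod>h\<in>half_edges G. \<phi> (x (hvert G h) - y (hedge h)))"
    by (intro sum.cong refl prod.group finite_half_edges finite_verts) (auto simp: half_edges_def hvert_def)
  finally show "(\<Sum>x\<in>vertex_funs G. \<Prod>h\<in>half_edges G. \<phi> (x (hvert G h) - y (hedge h))) =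
      (\<Prod>v\<in>verts G. \<Sum>a\<in>UNIV. \<Prod>h | h \<in> half_edges G \<and> hvert G h = v. \<phi> (a - y (hedge h)))" ..
qed

lemma sum_half_edges_by_head_tail:
  fixes \<phi> :: "'q::{comm_ring,finite} \<Rightarrow> complex"
  shows "(\<Sum>x\<in>vertex_funs G. \<Sum>y\<in>edge_funs G. \<Prod>h\<in>half_edges G. \<phi> (x (hvert G h) - y (hedge h))) =
    (\<Sum>x\<in>vertex_funs G. \<Prod>e\<in>arcs G. \<Sum>b\<in>UNIV. \<phi> (x (head G e) - b) * \<phi> (x (tail G e) - b))"
  unfolding sum_half_edges_by_edge
  by (intro sum.cong prod.cong refl) (simp add: half_edges_of_edge hvert_def)

section \<open>Flows: the sum over vertex functions as an indicator\<close>

lemma sum_vertex_funs_character: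
  fixes chi :: "'q::{comm_ring,finite} \<Rightarrow> complex"
  assumes gen: "generating_character chi"
  shows "(\<Sum>x\<in>vertex_funs G. chi (\<Sum>e\<in>arcs G. coboundary G x e * y e)) =
    (if boundary G y = (\<lambda>v\<in>verts G. 0) then of_nat CARD('q) ^ card (verts G) else 0)"
proof -
  have chi: "chi \<in> characters"
    using gen by (simp add: generating_character_def)
  \<comment> \<open>Adjointness rewrites the argument of chi as a sum over vertices, so the
    character splits into one factor per vertex and the sum over x becomes a product of
    orthogonality sums.\<close>
  have "(\<Sum>x\<in>vertex_funs G. chi (\<Sum>e\<in>arcs G. coboundary G x e * y e)) =
      (\<Sum>x\<in>vertex_funs G. \<Prod>v\<in>verts G. chi (x v * boundary G y v))"
    by (simp add: boundary_coboundary_adjoint fin_digraph_axioms character_sum[OF chi])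
  also have "\<dots> = (\<Prod>v\<in>verts G. \<Sum>a\<in>UNIV. chi (a * boundary G y v))"
    by (rule prod_sum_PiE[symmetric]) auto
  also have "\<dots> = (\<Prod>v\<in>verts G. if boundary G y v = 0 then of_nat CARD('q) else 0)"
    by (simp add: generating_character_orthogonality[OF gen])
  also have "\<dots> = (if \<forall>v\<in>verts G. boundary G y v = 0 then of_nat CARD('q) ^ card (verts G) else 0)"
    by (auto intro!: prod_zero)
  \<comment> \<open>\<open>boundary G y\<close> is extensional, so vanishing at every vertex already
    makes it equal to the restricted zero function.\<close>
  also have "(\<forall>v\<in>verts G. boundary G y v = 0) \<longleftrightarrow> boundary G y = (\<lambda>v\<in>verts G. 0)"
    by (auto simp: boundary_def restrict_def fun_eq_iff)
  finally show ?thesis .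
qed

lemma cwe_flows:
  fixes chi :: "'q::{comm_ring,finite} \<Rightarrow> complex"
  assumes gen: "generating_character chi"
  shows "(\<Sum>x\<in>vertex_funs G. \<Sum>y\<in>edge_funs G.
      \<Prod>h\<in>half_edges G. fourier chi g (x (hvert G h) - y (hedge h))) =
    of_nat CARD('q) ^ card (verts G) * cwe G (flows G) (ptmult g (reflect g))"
proof -
  have chi: "chi \<in> characters"
    using gen by (simp add: generating_character_def)
  let ?w = "ptmult g (reflect g)"
  have "(\<Sum>x\<in>vertex_funs G. \<Sum>y\<in>edge_funs G.
      \<Prod>h\<in>half_edges G. fourier chi g (x (hvert G h) - y (hedge h))) =
      (\<Sum>x\<in>vertex_funs G. \<Prod>e\<in>arcs G. \<Sum>c\<in>UNIV. chi (coboundary G x e * c) * ?w c)"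
    unfolding sum_half_edges_by_head_tail sum_fourier_shift[OF gen]
    by (intro sum.cong prod.cong refl) (simp add: coboundary_apply fin_digraph_axioms)
  \<comment> \<open>The distributive law is applied a second time: here y collects the Fourier
    variables c of the edges, and is unrelated to the y that was summed out at the start. This new y
    is the one that becomes a flow.\<close>
  also have "\<dots> = (\<Sum>x\<in>vertex_funs G. \<Sum>y\<in>edge_funs G. \<Prod>e\<in>arcs G. chi (coboundary G x e * y e) * ?w (y e))"
    by (intro sum.cong refl prod_sum_PiE) auto
  also have "\<dots> = (\<Sum>y\<in>edge_funs G. \<Sum>x\<in>vertex_funs G.
      chi (\<Sum>e\<in>arcs G. coboundary G x e * y e) * (\<Prod>e\<in>arcs G. ?w (y e)))"
    by (subst sum.swap) (simp add: prod.distrib character_sum[OF chi])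
  also have "\<dots> = (\<Sum>y\<in>edge_funs G. if boundary G y = (\<lambda>v\<in>verts G. 0)
      then of_nat CARD('q) ^ card (verts G) * (\<Prod>e\<in>arcs G. ?w (y e)) else 0)"
    unfolding sum_distrib_right[symmetric] sum_vertex_funs_character[OF gen]
    by (intro sum.cong refl) auto
  also have "\<dots> = (\<Sum>y\<in>flows G. of_nat CARD('q) ^ card (verts G) * (\<Prod>e\<in>arcs G. ?w (y e)))"
    unfolding flows_def
    by (rule sum.inter_filter[symmetric, OF finite_edge_funs])
  also have "\<dots> = of_nat CARD('q) ^ card (verts G) * cwe G (flows G) ?w"
    by (simp add: cwe_def sum_distrib_left)
  finally show ?thesis .
qed

section \<open>Components, fibres of the coboundary map and tensions\<close>

lemma card_locally_constant:
  "card {x \<in> vertex_funs G :: ('a \<Rightarrow> 'q::finite) set. \<forall>e\<in>arcs G. x (head G e) = x (tail G e)} =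
    CARD('q) ^ num_components G"
proof -
  define H where "H = with_proj (mk_symmetric G)"
  interpret S: pair_fin_digraph "mk_symmetric G" by (rule pair_fin_digraph_mk_symmetric)
  interpret H: fin_digraph H unfolding H_def by (rule S.fin_digraph_axioms)
  have verts_H: "verts H = verts G" by (simp add: H_def)
  have arcs_H: "arcs_ends H = (\<Union>e\<in>arcs G. {(tail G e, head G e), (head G e, tail G e)})"
    by (simp add: H_def parcs_mk_symmetric)
  let ?K = "{x \<in> vertex_funs G :: ('a \<Rightarrow> 'q) set. \<forall>e\<in>arcs G. x (head G e) = x (tail G e)}"
  let ?P = "H.sccs_verts \<rightarrow>\<^sub>E (UNIV :: 'q set)"
  \<comment> \<open>Pulling back along the map from a vertex to its component will be a bijection
    from the functions on components onto the functions constant along edges.\<close>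
  let ?F = "\<lambda>z. \<lambda>v\<in>verts G. z (H.scc_of v)"
  \<comment> \<open>\<open>H\<close> has arcs in both directions along each edge of
    \<open>G\<close>, so every step of a walk in \<open>H\<close> preserves the value of x.\<close>
  have const: "x u = x v" if "x \<in> ?K" "u \<rightarrow>\<^sup>*\<^bsub>H\<^esub> v" for x u v
    using that(2)
  proof (induction rule: H.reachable_induct)
    case (step v w)
    then show ?case using that(1) by (auto simp: arcs_H)
  qed simp
  have scc_head_tail: "H.scc_of (head G e) = H.scc_of (tail G e)" if "e \<in> arcs G" for e
  proof (rule H.scc_of_eq)
    have "tail G e \<rightarrow>\<^bsub>H\<^esub> head G e" "head G e \<rightarrow>\<^bsub>H\<^esub> tail G e"
      using that by (auto simp: arcs_H)
    then show "head G e \<in> H.scc_of (tail G e)"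
      by (auto simp: H.scc_of_def)
  qed
  have inj: "inj_on ?F ?P"
  proof (rule inj_onI)
    fix z z' assume z: "z \<in> ?P" "z' \<in> ?P" "?F z = ?F z'"
    show "z = z'"
    proof (rule PiE_ext[OF z(1,2)])
      fix S assume "S \<in> H.sccs_verts"
      then obtain v where "v \<in> verts G" "S = H.scc_of v"
        by (auto simp: H.sccs_verts_conv_scc_of verts_H)
      then show "z S = z' S" using fun_cong[OF z(3), of v] by simp
    qed
  qed
  have "?F ` ?P = ?K"
  proof (intro equalityI subsetI)
    fix x assume "x \<in> ?F ` ?P"
    then show "x \<in> ?K" by (auto simp: scc_head_tail)
  next
    fix x assume x: "x \<in> ?K"
    \<comment> \<open>The value on a component is read off at an arbitrary representative; by
      \<open>const\<close> the choice does not matter.\<close>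
    define z where "z = (\<lambda>S\<in>H.sccs_verts. x (SOME v. v \<in> S))"
    have "x = ?F z"
    proof
      fix v
      show "x v = ?F z v"
      proof (cases "v \<in> verts G")
        case True
        then have "v \<in> H.scc_of v" by (intro H.in_scc_of_self) (simp add: verts_H)
        then have "(SOME u. u \<in> H.scc_of v) \<in> H.scc_of v" by (rule someI)
        then have "x v = x (SOME u. u \<in> H.scc_of v)"
          by (intro const[OF x]) (simp add: H.scc_of_def)
        then show ?thesis
          using True by (simp add: z_def H.scc_of_in_sccs_verts verts_H)
      next
        case False
        then show ?thesis using x by (auto simp: PiE_def extensional_def)
      qed
    qed
    moreover have "z \<in> ?P" by (simp add: z_def)
    ultimately show "x \<in> ?F ` ?P" by blast
  qed
  then have "card ?K = card ?P"
    using card_image[OF inj] by (simp only:)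
  also have "\<dots> = CARD('q) ^ card H.sccs_verts"
    by (simp add: card_PiE H.finite_sccs_verts)
  finally show ?thesis by (simp add: num_components_def H_def)
qed

text \<open>Every component is the component of some vertex. This rules out truncation of the
  natural-number subtraction in \<open>graph_rank\<close>.\<close>

lemma num_components_le: "num_components G \<le> card (verts G)"
proof -
  interpret S: pair_fin_digraph "mk_symmetric G" by (rule pair_fin_digraph_mk_symmetric)
  show ?thesis
    unfolding num_components_def S.sccs_verts_conv_scc_of
    using card_image_le[OF finite_verts] by simp
qed

text \<open>Subtracting a fixed preimage x0 of t carries the fibre onto the functions constant along
  edges, which are already counted.\<close>

lemma card_coboundary_fibre:
  assumes t: "t \<in> (tensions G :: ('b \<Rightarrow> 'q::{comm_ring,finite}) set)"
  shows "card {x \<in> vertex_funs G. coboundary G x = t} = CARD('q) ^ num_components G"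
proof -
  obtain x0 where x0: "x0 \<in> vertex_funs G" "t = coboundary G x0"
    using t by (auto simp: tensions_def)
  have cob: "coboundary G x = t \<longleftrightarrow>
      (\<forall>e\<in>arcs G. x (head G e) - x (tail G e) = x0 (head G e) - x0 (tail G e))" for x
  proof -
    have "coboundary G x = t \<longleftrightarrow> (\<forall>e\<in>arcs G. coboundary G x e = coboundary G x0 e)"
      unfolding x0(2) by (auto simp: coboundary_def restrict_def fun_eq_iff)
    then show ?thesis by (simp add: coboundary_apply fin_digraph_axioms)
  qed
  \<comment> \<open>Both translations are restricted to \<open>verts G\<close> to keep the functions
    extensional.\<close>
  have "bij_betw (\<lambda>x. \<lambda>v\<in>verts G. x v - x0 v) {x \<in> vertex_funs G. coboundary G x = t}
      {x \<in> vertex_funs G. \<forall>e\<in>arcs G. x (head G e) = x (tail G e)}"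
    unfolding cob using x0(1)
    by (intro bij_betw_byWitness[where f' = "\<lambda>x. \<lambda>v\<in>verts G. x v + x0 v"])
      (auto simp: algebra_simps PiE_def extensional_def restrict_def fun_eq_iff)
  from bij_betw_same_card[OF this] show ?thesis
    by (simp only: card_locally_constant)
qed

text \<open>After summing out y, the summand depends on x only through its coboundary, so grouping
  by t counts each tension once for every element of its fibre.\<close>

lemma cwe_tensions:
  fixes f :: "'q::{comm_ring,finite} \<Rightarrow> complex"
  shows "(\<Sum>x\<in>vertex_funs G. \<Sum>y\<in>edge_funs G. \<Prod>h\<in>half_edges G. f (x (hvert G h) - y (hedge h))) =
    of_nat CARD('q) ^ num_components G * cwe G (tensions G) (convol f (reflect f))"
proof -
  let ?w = "convol f (reflect f)"
  have "(\<Sum>x\<in>vertex_funs G. \<Sum>y\<in>edge_funs G. \<Prod>h\<in>half_edges G. f (x (hvert G h) - y (hedge h))) =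
      (\<Sum>x\<in>vertex_funs G. \<Prod>e\<in>arcs G. ?w (coboundary G x e))"
    unfolding sum_half_edges_by_head_tail sum_shift_eq_convol
    by (intro sum.cong prod.cong refl) (simp add: coboundary_apply fin_digraph_axioms)
  also have "\<dots> = (\<Sum>t\<in>tensions G.
      of_nat (card {x \<in> vertex_funs G. coboundary G x = t}) * (\<Prod>e\<in>arcs G. ?w (t e)))"
    by (rule sum_fun_comp) (auto simp: tensions_def finite_vertex_funs)
  also have "\<dots> = of_nat CARD('q) ^ num_components G * cwe G (tensions G) ?w"
    by (simp add: card_coboundary_fibre cwe_def sum_distrib_left)
  finally show ?thesis .
qed

end

section \<open>The identities for both weight enumerators\<close>

theorem theorem3p4:
  fixes chi :: "'q::{comm_ring,finite} \<Rightarrow> complex"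
    and G :: "('v, 'e) pre_digraph"
    and f g :: "'q \<Rightarrow> complex"
  assumes unity: "\<exists>u::'q. \<forall>a. u * a = a"
    and generating: "generating_character chi"
    and graph: "fin_digraph G"
  shows
    "cwe G (flows G) (ptmult g (reflect g)) =
       of_nat CARD('q) powi (- int (card (verts G))) *
       (\<Sum>x\<in>vertex_funs G. \<Prod>e\<in>arcs G. \<Sum>b\<in>UNIV.
          \<Prod>h | h \<in> half_edges G \<and> hedge h = e. fourier chi g (x (hvert G h) - b))
     \<and>
     cwe G (flows G) (ptmult g (reflect g)) =
       of_nat CARD('q) powi (- int (card (verts G))) *
       (\<Sum>y\<in>edge_funs G. \<Prod>v\<in>verts G. \<Sum>a\<in>UNIV.
          \<Prod>h | h \<in> half_edges G \<and> hvert G h = v. fourier chi g (a - y (hedge h)))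
     \<and>
     (\<forall>(M :: 'w measure) (X :: 'w \<Rightarrow> 'v \<Rightarrow> 'q) (Y :: 'w \<Rightarrow> 'e \<Rightarrow> 'q).
        independent_uniform M (vertex_funs G) X (edge_funs G) Y \<longrightarrow>
          cwe G (flows G) (ptmult g (reflect g)) =
            of_nat CARD('q) ^ card (arcs G) *
            (\<integral>\<omega>. (\<Prod>h\<in>half_edges G. fourier chi g (X \<omega> (hvert G h) - Y \<omega> (hedge h))) \<partial>M)
        \<and>
          cwe G (tensions G) (convol f (reflect f)) =
            of_nat CARD('q) ^ (card (arcs G) + graph_rank G) *
            (\<integral>\<omega>. (\<Prod>h\<in>half_edges G. f (X \<omega> (hvert G h) - Y \<omega> (hedge h))) \<partial>M))"
proof -
  interpret fin_digraph G by (rule graph)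
  define q :: complex where "q = of_nat CARD('q)"
  have q: "q \<noteq> 0" by (simp add: q_def)
  \<comment> \<open>All four formulas are expressions for this one sum, taken at the Fourier
    transform of g or at f.\<close>
  define T where "T \<phi> = (\<Sum>x\<in>vertex_funs G. \<Sum>y\<in>edge_funs G.
    \<Prod>h\<in>half_edges G. \<phi> (x (hvert G h) - y (hedge h)))" for \<phi> :: "'q \<Rightarrow> complex"
  have T_flows: "T (fourier chi g) = q ^ card (verts G) * cwe G (flows G) (ptmult g (reflect g))"
    unfolding T_def q_def by (rule cwe_flows[OF generating])
  have T_tensions: "T f = q ^ num_components G * cwe G (tensions G) (convol f (reflect f))"
    unfolding T_def q_def by (rule cwe_tensions)
  have cwe_eq: "cwe G (flows G) (ptmult g (reflect g)) =
      q powi (- int (card (verts G))) * T (fourier chi g)"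
    unfolding T_flows using q by (simp add: power_int_minus field_simps)
  \<comment> \<open>There are q^(|V| + |E|) equally likely pairs (x, y), so the expectation is the
    average of the summands of T.\<close>
  have expectation: "(\<integral>\<omega>. (\<Prod>h\<in>half_edges G. \<phi> (X \<omega> (hvert G h) - Y \<omega> (hedge h))) \<partial>M) =
      T \<phi> / (q ^ card (verts G) * q ^ card (arcs G))"
    if "independent_uniform M (vertex_funs G) X (edge_funs G) Y"
    for M :: "'w measure" and X :: "'w \<Rightarrow> 'v \<Rightarrow> 'q" and Y :: "'w \<Rightarrow> 'e \<Rightarrow> 'q" and \<phi>
    using integral_independent_uniform[OF that finite_vertex_funs finite_edge_funs,
        of "\<lambda>x y. \<Prod>h\<in>half_edges G. \<phi> (x (hvert G h) - y (hedge h))"]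
    by (simp add: T_def q_def card_vertex_funs card_edge_funs)
  \<comment> \<open>This splits |V| into rank and number of components; the component part cancels
    the fibre size in \<open>T_tensions\<close> and leaves the exponent |E| + r(E).\<close>
  have rank: "q ^ card (verts G) = q ^ graph_rank G * q ^ num_components G"
    using num_components_le by (simp add: graph_rank_def flip: power_add)
  show ?thesis
    unfolding q_def[symmetric]
  proof (intro conjI allI impI)
    show "cwe G (flows G) (ptmult g (reflect g)) = q powi (- int (card (verts G))) *
        (\<Sum>x\<in>vertex_funs G. \<Prod>e\<in>arcs G. \<Sum>b\<in>UNIV.
          \<Prod>h | h \<in> half_edges G \<and> hedge h = e. fourier chi g (x (hvert G h) - b))"
      unfolding cwe_eq T_def sum_half_edges_by_edge ..
    show "cwe G (flows G) (ptmult g (reflect g)) = q powi (- int (card (verts G))) *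
        (\<Sum>y\<in>edge_funs G. \<Prod>v\<in>verts G. \<Sum>a\<in>UNIV.
          \<Prod>h | h \<in> half_edges G \<and> hvert G h = v. fourier chi g (a - y (hedge h)))"
      unfolding cwe_eq T_def sum_half_edges_by_vertex ..
  next
    fix M :: "'w measure" and X :: "'w \<Rightarrow> 'v \<Rightarrow> 'q" and Y :: "'w \<Rightarrow> 'e \<Rightarrow> 'q"
    assume XY: "independent_uniform M (vertex_funs G) X (edge_funs G) Y"
    show "cwe G (flows G) (ptmult g (reflect g)) = q ^ card (arcs G) *
        (\<integral>\<omega>. (\<Prod>h\<in>half_edges G. fourier chi g (X \<omega> (hvert G h) - Y \<omega> (hedge h))) \<partial>M)"
      unfolding expectation[OF XY] T_flows using q by simp
    show "cwe G (tensions G) (convol f (reflect f)) = q ^ (card (arcs G) + graph_rank G) *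
        (\<integral>\<omega>. (\<Prod>h\<in>half_edges G. f (X \<omega> (hvert G h) - Y \<omega> (hedge h))) \<partial>M)"
      unfolding expectation[OF XY] T_tensions rank using q by (simp add: power_add)
  qed
qed

end
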